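(* Let $f:\mathbb{R}^n\to\mathbb{R}^n$ and $g:\mathbb{R}^n\to\mathbb{R}^{n\times m}$ be continuous, let $\varepsilon\in(0,1)$, $\alpha\in[0,1]$, let $\Sigma_w\in\mathbb{R}^{n\times n}$ be symmetric positive definite, and let $\mathcal{P}$ be the set of all probability distributions on $\mathbb{R}^n$ with mean $0$ and covariance matrix $\Sigma_w$. Let $Q\in\mathbb{R}^{n\times p}$, $r\in\mathbb{R}^p$ and $h:\mathbb{R}^n\to\mathbb{R}^p$, $h(x)=Q^\top x+r$. For $x\in\mathbb{R}^n$ and $u\in\mathbb{R}^m$, write $x^+=f(x)+g(x)u+w$, where $w$ is a random vector in $\mathbb{R}^n$ with law $\mathbb{P}\in\mathcal{P}$. Then for every $x\in\mathbb{R}^n$ and $u\in\mathbb{R}^m$, the (element-wise) constraint $$\sup_{\mathbb{P}\in\mathcal{P}}\mathbb{P}\text{-CVaR}_{\varepsilon}[-h(x^+)]\le-\alpha h(x)$$ holds if and only if, element-wise, $$-Q^\top g(x)u\le\phi(x),$$ where $$\phi(x)=Q^\top(f(x)-\alpha x)+(1-\alpha)r-\sup_{\mathbb{P}\in\mathcal{P}}\mathbb{P}\text{-CVaR}_{\varepsilon}[Q^\top w].$$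
   Context: For a measurable loss function $L:\mathbb{R}^n\to\mathbb{R}$, a probability distribution $\mathbb{P}$ on $\mathbb{R}^n$ (the law of the random vector $w$) and a level $\varepsilon\in(0,1)$, the Conditional Value-at-Risk is $$\mathbb{P}\text{-CVaR}_{\varepsilon}[L(w)]=\inf_{\beta\in\mathbb{R}}\left\{\beta+\frac1\varepsilon\,\mathbb{E}_{\mathbb{P}}\big[(L(w)-\beta)^+\big]\right\},$$ where $(a)^+=\max(a,0)$. The worst-case CVaR over $\mathcal{P}$ is the supremum of this quantity over $\mathbb{P}\in\mathcal{P}$. For a vector-valued $v=(v_1,\dots,v_p)^\top$, the worst-case CVaR is taken element-wise: $\sup_{\mathbb{P}\in\mathcal{P}}\mathbb{P}\text{-CVaR}_\varepsilon[v]$ is the vector whose $i$-th entry is $\sup_{\mathbb{P}\in\mathcal{P}}\mathbb{P}\text{-CVaR}_\varepsilon[v_i]$; vector inequalities are also element-wise. In $\text{CVaR}_\varepsilon[-h(x^+)]$ the vectors $x,u$ are deterministic and only $w$ is random. *)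

theory Defs
  imports "HOL-Probability.Probability"
begin

definition symmetric_pos_def :: "real ^ 'n ^ 'n \<Rightarrow> bool" where
  "symmetric_pos_def A \<longleftrightarrow>
     transpose A = A \<and> (\<forall>v. v \<noteq> 0 \<longrightarrow> v \<bullet> (A *v v) > 0)"

text \<open>The integrability conjuncts below say that the mean and the covariance matrix exist:
  the Bochner integral of a non-integrable function is \<open>0\<close>.\<close>

definition has_mean :: "(real ^ 'n) measure \<Rightarrow> real ^ 'n \<Rightarrow> bool" where
  "has_mean M \<mu> \<longleftrightarrow> integrable M (\<lambda>w. w) \<and> (LINT w|M. w) = \<mu>"

definition has_covariance :: "(real ^ 'n) measure \<Rightarrow> real ^ 'n ^ 'n \<Rightarrow> bool" where
  "has_covariance M C \<longleftrightarrow>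
     (\<forall>i j. integrable M (\<lambda>w. (w $ i - (LINT v|M. v) $ i) * (w $ j - (LINT v|M. v) $ j)) \<and>
        (LINT w|M. (w $ i - (LINT v|M. v) $ i) * (w $ j - (LINT v|M. v) $ j)) = C $ i $ j)"

definition ambiguity_set :: "real ^ 'n ^ 'n \<Rightarrow> (real ^ 'n) measure set" where
  "ambiguity_set C =
     {M. prob_space M \<and> sets M = sets borel \<and> has_mean M 0 \<and> has_covariance M C}"

text \<open>Values are extended reals and the expectation of the (nonnegative) excess loss is a
  nonnegative integral, so that the infimum over \<open>\<beta>\<close> and the supremum over the ambiguity set
  are defined for every measurable loss, with no default values.\<close>

definition CVaR :: "'a measure \<Rightarrow> real \<Rightarrow> ('a \<Rightarrow> real) \<Rightarrow> ereal" where
  "CVaR M \<epsilon> L =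
     (INF \<beta>::real. ereal \<beta> + ereal (1 / \<epsilon>) * enn2ereal (\<integral>\<^sup>+ w. ennreal (max (L w - \<beta>) 0) \<partial>M))"

definition worst_case_CVaR ::
    "'a measure set \<Rightarrow> real \<Rightarrow> ('a \<Rightarrow> real ^ 'p) \<Rightarrow> ereal ^ 'p" where
  "worst_case_CVaR \<P> \<epsilon> v = (\<chi> i. SUP M\<in>\<P>. CVaR M \<epsilon> (\<lambda>w. v w $ i))"

definition ereal_vec :: "real ^ 'p \<Rightarrow> ereal ^ 'p" where
  "ereal_vec v = (\<chi> i. ereal (v $ i))"

end

(* CVaR is equivariant under adding a constant to the loss, so the deterministic part of -h(x+)
   comes out of the worst case and -Q^T w remains. Mean 0 and a prescribed covariance are
   invariant under the reflection w |-> -w, so -Q^T w and Q^T w have the same worst-case CVaR. The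
   rest is a rearrangement of finite summands around one extended real, valid even if that is
   infinite. *)

theory Submission
  imports Defs
begin

text \<open>Since \<open>L w + c - \<beta> = L w - (\<beta> - c)\<close>, the objective at
  \<open>\<beta>\<close> for the shifted loss is \<open>c\<close> plus the objective
  \<open>G\<close> for \<open>L\<close> at \<open>\<beta> - c\<close>, and
  \<open>\<beta> - c\<close> runs over all reals.\<close>

lemma CVaR_add_const: "CVaR M \<epsilon> (\<lambda>w. L w + c) = CVaR M \<epsilon> L + ereal c"
proof -
  define G where "G \<beta> = ereal \<beta> + ereal (1 / \<epsilon>) *
    enn2ereal (\<integral>\<^sup>+ w. ennreal (max (L w - \<beta>) 0) \<partial>M)" for \<beta>
  \<comment> \<open>The sum is disguised as a difference with a double negation so that
    \<open>INF_ereal_minus_right\<close>, which needs only the minuend \<open>ereal c\<close> to be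
    finite, can pull it out of the infimum; \<open>G\<close> itself may be infinite.\<close>
  have shift: "ereal \<beta> + ereal (1 / \<epsilon>) *
      enn2ereal (\<integral>\<^sup>+ w. ennreal (max (L w + c - \<beta>) 0) \<partial>M) = ereal c - (- G (\<beta> - c))" for \<beta>
  proof -
    have L: "L w + c - \<beta> = L w - (\<beta> - c)" for w by simp
    have "ereal \<beta> = ereal c + ereal (\<beta> - c)" by simp
    then show ?thesis
      unfolding G_def L minus_ereal_def ereal_uminus_uminus by (simp only: add.assoc)
  qed
  have "CVaR M \<epsilon> (\<lambda>w. L w + c) = (INF \<beta>. ereal c - (- G (\<beta> - c)))"
    by (simp only: CVaR_def shift)
  also have "\<dots> = (INF \<beta>. G (\<beta> - c)) + ereal c"
  proof -
    have "(INF \<beta>. ereal c - (- G (\<beta> - c))) = ereal c - (SUP \<beta>. - G (\<beta> - c))"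
      by (rule INF_ereal_minus_right) simp_all
    then show ?thesis
      by (simp only: ereal_SUP_uminus_eq minus_ereal_def ereal_uminus_uminus add.commute)
  qed
  also have "(INF \<beta>. G (\<beta> - c)) = (INF \<beta>. G \<beta>)"
  proof -
    have "range (\<lambda>\<beta>. \<beta> - c) = UNIV"
      by (rule surjI[of _ "\<lambda>\<beta>. \<beta> + c"]) simp
    then have "range (\<lambda>\<beta>. G (\<beta> - c)) = range G"
      using image_image[of G "\<lambda>\<beta>. \<beta> - c" UNIV] by simp
    then show ?thesis by simp
  qed
  finally show ?thesis
    by (simp only: CVaR_def G_def)
qed

lemma CVaR_distr:
  assumes "T \<in> measurable M N" "L \<in> borel_measurable N"
  shows "CVaR (distr M N T) \<epsilon> L = CVaR M \<epsilon> (\<lambda>w. L (T w))"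
  unfolding CVaR_def using assms by (subst nn_integral_distr) simp_all

lemma measurable_uminus_ambiguity_set:
  fixes C :: "real ^ 'n ^ 'n"
  assumes "M \<in> ambiguity_set C"
  shows "uminus \<in> measurable M borel"
proof -
  have "sets M = sets borel"
    using assms by (simp add: ambiguity_set_def)
  moreover have "uminus \<in> measurable borel (borel :: (real ^ 'n) measure)"
    by (intro borel_measurable_continuous_onI continuous_intros)
  ultimately show ?thesis
    using measurable_cong_sets[of M borel borel "borel :: (real ^ 'n) measure"] by simp
qed

text \<open>Integrating against the reflected law means integrating the reflected integrand: the
  mean changes sign and stays 0, while in \<open>w $ i * w $ j\<close> the two signs cancel.\<close>

lemma distr_uminus_ambiguity_set:
  fixes C :: "real ^ 'n ^ 'n"
  assumes "M \<in> ambiguity_set C"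
  shows "distr M borel uminus \<in> ambiguity_set C"
proof -
  have M: "prob_space M" "integrable M (\<lambda>w. w)" "(LINT w|M. w) = 0"
    using assms by (simp_all add: ambiguity_set_def has_mean_def)
  have "has_covariance M C"
    using assms by (simp add: ambiguity_set_def)
  then have cov: "integrable M (\<lambda>w. w $ i * w $ j)" "(LINT w|M. w $ i * w $ j) = C $ i $ j" for i j
    by (simp_all add: has_covariance_def M(3))
  note meas = measurable_uminus_ambiguity_set[OF assms]
  have comp: "(\<lambda>w :: real ^ 'n. w $ i * w $ j) \<in> borel_measurable borel" for i j
    by (intro borel_measurable_continuous_onI continuous_intros)
  have ident: "(\<lambda>w. w) \<in> borel_measurable (borel :: (real ^ 'n) measure)"
    by (rule borel_measurable_continuous_onI) (rule continuous_on_id)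
  have mean: "has_mean (distr M borel uminus) 0"
    using M by (simp add: has_mean_def integrable_distr_eq[OF meas ident] integral_distr[OF meas ident])
  \<comment> \<open>Covariance is centred at the mean of the measure at hand, so the zero mean of
    the reflected law has to come first; it reduces the centred products to
    \<open>w $ i * w $ j\<close>.\<close>
  then have "has_covariance (distr M borel uminus) C"
    using cov by (simp add: has_mean_def has_covariance_def
        integrable_distr_eq[OF meas comp] integral_distr[OF meas comp])
  with mean show ?thesis
    by (simp add: ambiguity_set_def prob_space.prob_space_distr[OF M(1) meas])
qed

lemma SUP_CVaR_uminus:
  fixes L :: "real ^ 'n \<Rightarrow> real"
  assumes "L \<in> borel_measurable borel"
  shows "(SUP M\<in>ambiguity_set C. CVaR M \<epsilon> (\<lambda>w. L (- w))) = (SUP M\<in>ambiguity_set C. CVaR M \<epsilon> L)"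
proof -
  \<comment> \<open>One inequality for arbitrary \<open>K\<close> suffices: \<open>K = L\<close>
    gives one direction, and \<open>K = (\<lambda>w. L (- w))\<close> gives the other because
    reflecting twice restores \<open>L\<close>.\<close>
  have le: "(SUP M\<in>ambiguity_set C. CVaR M \<epsilon> (\<lambda>w. K (- w))) \<le> (SUP M\<in>ambiguity_set C. CVaR M \<epsilon> K)"
    if "K \<in> borel_measurable borel" for K :: "real ^ 'n \<Rightarrow> real"
  proof (rule SUP_mono)
    fix M :: "(real ^ 'n) measure"
    assume M: "M \<in> ambiguity_set C"
    have "CVaR M \<epsilon> (\<lambda>w. K (- w)) = CVaR (distr M borel uminus) \<epsilon> K"
      by (rule CVaR_distr[OF measurable_uminus_ambiguity_set[OF M] that, symmetric])
    then show "\<exists>N\<in>ambiguity_set C. CVaR M \<epsilon> (\<lambda>w. K (- w)) \<le> CVaR N \<epsilon> K"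
      using distr_uminus_ambiguity_set[OF M] by (intro bexI) simp_all
  qed
  have "(\<lambda>w. L (- w)) \<in> borel_measurable borel"
    using assms by measurable
  from le[OF assms] le[OF this] show ?thesis
    by (intro antisym) simp_all
qed

theorem mainTheorem5:
  fixes f :: "real ^ 'n \<Rightarrow> real ^ 'n"
    and g :: "real ^ 'n \<Rightarrow> real ^ 'm ^ 'n"
    and \<epsilon> \<alpha> :: real
    and \<Sigma>\<^sub>w :: "real ^ 'n ^ 'n"
    and \<P> :: "(real ^ 'n) measure set"
    and Q :: "real ^ 'p ^ 'n"
    and r :: "real ^ 'p"
    and h :: "real ^ 'n \<Rightarrow> real ^ 'p"
    and \<phi> :: "real ^ 'n \<Rightarrow> ereal ^ 'p"
  assumes "continuous_on UNIV f"
    and "continuous_on UNIV g"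
    and "0 < \<epsilon>" and "\<epsilon> < 1"
    and "0 \<le> \<alpha>" and "\<alpha> \<le> 1"
    and "symmetric_pos_def \<Sigma>\<^sub>w"
    and "\<P> = ambiguity_set \<Sigma>\<^sub>w"
    and "\<And>x. h x = transpose Q *v x + r"
    and "\<And>x. \<phi> x =
           ereal_vec (transpose Q *v (f x - \<alpha> *\<^sub>R x) + (1 - \<alpha>) *\<^sub>R r)
             - worst_case_CVaR \<P> \<epsilon> (\<lambda>w. transpose Q *v w)"
  shows "\<forall>(x :: real ^ 'n) (u :: real ^ 'm).
    worst_case_CVaR \<P> \<epsilon> (\<lambda>w. - h (f x + g x *v u + w)) \<le> ereal_vec (- (\<alpha> *\<^sub>R h x))
    \<longleftrightarrow> ereal_vec (- (transpose Q *v (g x *v u))) \<le> \<phi> x"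
proof (intro allI)
  fix x :: "real ^ 'n" and u :: "real ^ 'm"
  define A where "A = transpose Q"
  define S where "S i = (SUP M\<in>\<P>. CVaR M \<epsilon> (\<lambda>w. (A *v w) $ i))" for i
  have loss: "(- h (f x + g x *v u + w)) $ i = (A *v (- w)) $ i + (- h (f x + g x *v u)) $ i" for w i
    by (simp add: assms(9) A_def[symmetric] matrix_vector_right_distrib vec.neg)
  have "(SUP M\<in>\<P>. CVaR M \<epsilon> (\<lambda>w. (- h (f x + g x *v u + w)) $ i))
      = S i + ereal ((- h (f x + g x *v u)) $ i)" for i
  \<comment> \<open>\<open>SUP_ereal_add_left\<close> asks for a nonempty index set. Over the empty
    set the supremum is minus infinity, which absorbs the finite constant.\<close>
  proof (cases "\<P> = {}")
    case True
    then show ?thesis by (simp add: S_def bot_ereal_def)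
  next
    case False
    have "(\<lambda>w. (A *v w) $ i) \<in> borel_measurable borel"
      by (intro borel_measurable_continuous_onI continuous_intros)
    from SUP_CVaR_uminus[OF this, of \<epsilon> \<Sigma>\<^sub>w]
    have "(SUP M\<in>\<P>. CVaR M \<epsilon> (\<lambda>w. (A *v (- w)) $ i)) = S i"
      by (simp only: assms(8) S_def)
    then show ?thesis
      unfolding loss CVaR_add_const using False by (subst SUP_ereal_add_left) auto
  qed
  \<comment> \<open>For real \<open>S i\<close> this moves finite terms across, using linearity of
    \<open>A\<close>. At plus infinity both sides are false, and at minus infinity both are
    true.\<close>
  moreover have "S i + ereal ((- h (f x + g x *v u)) $ i) \<le> ereal ((- (\<alpha> *\<^sub>R h x)) $ i) \<longleftrightarrow>
      ereal ((- (A *v (g x *v u))) $ i)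
        \<le> ereal ((A *v (f x - \<alpha> *\<^sub>R x) + (1 - \<alpha>) *\<^sub>R r) $ i) - S i" for i
    by (cases "S i")
      (auto simp: assms(9) A_def[symmetric] matrix_vector_right_distrib vec.diff
        matrix_vector_mult_scaleR algebra_simps)
  ultimately show "worst_case_CVaR \<P> \<epsilon> (\<lambda>w. - h (f x + g x *v u + w)) \<le> ereal_vec (- (\<alpha> *\<^sub>R h x))
    \<longleftrightarrow> ereal_vec (- (transpose Q *v (g x *v u))) \<le> \<phi> x"
    by (simp only: less_eq_vec_def worst_case_CVaR_def ereal_vec_def assms(10) vec_lambda_beta
        vector_minus_component S_def A_def)
qed

end
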